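(* For any integer $v\ge 8$, $T(v)\le 3v$.
   Context: A symmetric configuration $v_3$ is a finite incidence structure with $v$ points and $v$ blocks such that each block contains exactly $3$ points, each point is contained in exactly $3$ blocks, and any pair of distinct points is contained in at most one block. It is connected (indecomposable) if it is not the union of two configurations on disjoint point sets. All configurations here are assumed to be connected. A triangle in a configuration is a set of three distinct blocks of the form $\{a,b,f\},\{a,c,e\},\{b,c,d\}$, where $a,b,c,d,e,f$ are six distinct points. For a connected symmetric configuration $C$ with parameters $v_3$, $t(C)$ denotes the number of triangles in $C$. For $v\ge 7$, $T(v)$ denotes the maximum value of $t(C)$ over all connected symmetric configurations $C$ with parameters $v_3$. *)

theory Defs
  imports Main
begin

text \<open>A symmetric configuration with parameters $v_3$. Two distinct blocks share at most one
  point and have three points each, so a block is identified with its set of points.\<close>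

definition sym_configuration :: "nat \<Rightarrow> 'a set \<Rightarrow> 'a set set \<Rightarrow> bool" where
  "sym_configuration v P B \<longleftrightarrow>
     finite P \<and> card P = v \<and> finite B \<and> card B = v \<and>
     (\<forall>b\<in>B. b \<subseteq> P \<and> card b = 3) \<and>
     (\<forall>p\<in>P. card {b \<in> B. p \<in> b} = 3) \<and>
     (\<forall>p\<in>P. \<forall>q\<in>P. p \<noteq> q \<longrightarrow> card {b \<in> B. p \<in> b \<and> q \<in> b} \<le> 1)"

text \<open>The parts of a decomposition must have points, since the empty structure satisfies
  the definition above with $v = 0$. Requiring both parts to be symmetric is no restriction:
  if every block has 3 points and every point lies on 3 blocks, double counting gives
  equally many points and blocks.\<close>

definition decomposable :: "'a set \<Rightarrow> 'a set set \<Rightarrow> bool" where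
  "decomposable P B \<longleftrightarrow>
     (\<exists>v1 v2 P1 P2 B1 B2. 0 < v1 \<and> 0 < v2 \<and>
        sym_configuration v1 P1 B1 \<and> sym_configuration v2 P2 B2 \<and>
        P1 \<inter> P2 = {} \<and> P = P1 \<union> P2 \<and> B = B1 \<union> B2)"

definition connected_configuration :: "nat \<Rightarrow> 'a set \<Rightarrow> 'a set set \<Rightarrow> bool" where
  "connected_configuration v P B \<longleftrightarrow> sym_configuration v P B \<and> \<not> decomposable P B"

text \<open>Distinctness of the six points makes the three blocks distinct.\<close>

definition triangle :: "'a set set \<Rightarrow> 'a set set \<Rightarrow> bool" where
  "triangle B S \<longleftrightarrow> S \<subseteq> B \<and>
     (\<exists>a b c d e f. distinct [a, b, c, d, e, f] \<and> S = {{a, b, f}, {a, c, e}, {b, c, d}})"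

definition num_triangles :: "'a set set \<Rightarrow> nat" where
  "num_triangles B = card {S. triangle B S}"

text \<open>Every finite configuration is isomorphic to one whose points are natural numbers, and
  the number of triangles is invariant under isomorphism, so points of type \<^typ>\<open>nat\<close> suffice.
  For $v \ge 7$ the set below is finite and nonempty (for instance, the blocks
  $\{i, i+1, i+3\}$ modulo $v$ form a connected configuration), so \<^const>\<open>Max\<close> is the genuine
  maximum; for $v < 7$ no configuration $v_3$ with $v > 0$ exists and the value is irrelevant.\<close>

definition max_triangles :: "nat \<Rightarrow> nat" where
  "max_triangles v =
     Max {num_triangles B | (P :: nat set) (B :: nat set set). connected_configuration v P B}"

end

theory Submission imports Defs begin

text \<open>For a point \<open>p\<close> and a block \<open>b\<close> not through \<open>p\<close>, let \<open>k\<close> be the number of points of \<open>b\<close>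
  collinear with \<open>p\<close>. There are \<open>k choose 2\<close> triangles in which \<open>p\<close> is the vertex opposite to \<open>b\<close>,
  and for fixed \<open>p\<close> the numbers \<open>k\<close> add up to 12. Since \<open>k choose 2\<close> equals \<open>k\<close> for \<open>k \<in> {0, 3}\<close> and
  \<open>k - 1\<close> for \<open>k \<in> {1, 2}\<close>, it suffices that the number \<open>d p\<close> of blocks of the latter kind, called
  irregular at \<open>p\<close>, is at least 3 on average.

  If \<open>d p = 0\<close>, then \<open>p\<close> and its neighbours form a Fano plane, which splits off; \<open>d p = 1\<close>
  contradicts the sum 12 modulo 3. If \<open>d p = 2\<close>, then \<open>p\<close> lies in a Fano plane with one line
  \<open>{x, y, z}\<close> missing, where \<open>z\<close> is on the irregular block with \<open>k = 1\<close>. The deficit of \<open>p\<close> is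
  charged to \<open>z\<close>: one has \<open>d z \<ge> 8\<close>, and at most five points charge the same \<open>z\<close>.\<close>

section \<open>Incidence counts around a point\<close>

locale configuration =
  fixes v :: nat and P :: "'a set" and B :: "'a set set"
  assumes config: "sym_configuration v P B"
begin

lemma finite_points: "finite P" and card_points: "card P = v"
  and finite_blocks: "finite B"
  using config by (auto simp: sym_configuration_def)

lemma block_subset: "b \<in> B \<Longrightarrow> b \<subseteq> P" and card_block: "b \<in> B \<Longrightarrow> card b = 3"
  using config by (auto simp: sym_configuration_def)

lemma finite_block: "b \<in> B \<Longrightarrow> finite b"
  using card_block card.infinite by fastforce

lemma block_eqI:
  assumes "a \<in> B" "b \<in> B" "p \<in> a" "q \<in> a" "p \<in> b" "q \<in> b" "p \<noteq> q"
  shows "a = b"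
proof -
  have "p \<in> P" "q \<in> P" using assms block_subset by auto
  then have "card {b \<in> B. p \<in> b \<and> q \<in> b} \<le> 1"
    using config assms(7) by (auto simp: sym_configuration_def)
  moreover have "finite {b \<in> B. p \<in> b \<and> q \<in> b}" using finite_blocks by auto
  ultimately show ?thesis using assms by (auto simp: card_le_Suc0_iff_eq)
qed

definition pencil :: "'a \<Rightarrow> 'a set set" where
  "pencil p = {b \<in> B. p \<in> b}"

definition nb :: "'a \<Rightarrow> 'a set" where
  "nb p = {q. q \<noteq> p \<and> (\<exists>b\<in>B. p \<in> b \<and> q \<in> b)}"

definition opp :: "'a \<Rightarrow> 'a set set" where
  "opp p = {b \<in> B. p \<notin> b}"

definition irr :: "'a \<Rightarrow> 'a set set" where
  "irr p = {b \<in> opp p. card (b \<inter> nb p) = 1 \<or> card (b \<inter> nb p) = 2}"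

lemma finite_pencil: "finite (pencil p)" and finite_opp: "finite (opp p)"
  and finite_irr: "finite (irr p)"
  using finite_blocks by (auto simp: pencil_def opp_def irr_def)

lemma card_pencil: "p \<in> P \<Longrightarrow> card (pencil p) = 3"
  using config by (auto simp: sym_configuration_def pencil_def)

lemma nb_subset: "nb p \<subseteq> P"
  using block_subset by (auto simp: nb_def)

lemma finite_nb: "finite (nb p)"
  using nb_subset finite_points finite_subset by blast

lemma card_nb:
  assumes "p \<in> P"
  shows "card (nb p) = 6"
proof -
  have "nb p = (\<Union>b\<in>pencil p. b - {p})" by (auto simp: nb_def pencil_def)
  moreover have "card (\<Union>b\<in>pencil p. b - {p}) = (\<Sum>b\<in>pencil p. card (b - {p}))"
  proof (rule card_UN_disjoint)
    show "\<forall>b\<in>pencil p. finite (b - {p})" using finite_block by (auto simp: pencil_def)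
    show "\<forall>a\<in>pencil p. \<forall>b\<in>pencil p. a \<noteq> b \<longrightarrow> (a - {p}) \<inter> (b - {p}) = {}"
      using block_eqI by (fastforce simp: pencil_def)
  qed (rule finite_pencil)
  moreover have "(\<Sum>b\<in>pencil p. card (b - {p})) = (\<Sum>b\<in>pencil p. 2)"
    by (rule sum.cong) (auto simp: pencil_def card_block)
  ultimately show ?thesis using card_pencil[OF assms] by simp
qed

text \<open>Of the three blocks through \<open>q\<close>, exactly one joins \<open>q\<close> to
  \<open>p\<close>; the other two avoid \<open>p\<close>.\<close>

lemma card_opp_through:
  assumes "q \<in> nb p"
  shows "card {b \<in> opp p. q \<in> b} = 2"
proof -
  obtain l where l: "l \<in> B" "p \<in> l" "q \<in> l" "q \<noteq> p" using assms by (auto simp: nb_def)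
  have "{b \<in> opp p. q \<in> b} = pencil q - {l}"
    using l block_eqI by (auto simp: opp_def pencil_def)
  moreover have "l \<in> pencil q" using l by (auto simp: pencil_def)
  moreover have "q \<in> P" using assms nb_subset by auto
  ultimately show ?thesis using card_pencil by simp
qed

text \<open>Double counting of incidences between the six neighbours of \<open>p\<close> and the
  blocks avoiding \<open>p\<close>, with two such blocks through each neighbour.\<close>

lemma sum_card_nb:
  assumes "p \<in> P"
  shows "(\<Sum>b\<in>opp p. card (b \<inter> nb p)) = 12"
proof -
  have "(\<Sum>b\<in>opp p. card {q \<in> nb p. q \<in> b}) = (\<Sum>q\<in>nb p. 2)"
    by (rule sum_multicount_gen) (use finite_opp finite_nb card_opp_through in auto)
  moreover have "{q \<in> nb p. q \<in> b} = b \<inter> nb p" for b by auto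
  ultimately show ?thesis using card_nb[OF assms] by simp
qed

lemma card_inter_le: "b \<in> opp p \<Longrightarrow> card (b \<inter> nb p) \<le> 3"
  using card_block[of b] card_mono[OF finite_block, of b "b \<inter> nb p"] by (auto simp: opp_def)

lemma sum_choose:
  assumes "p \<in> P"
  shows "(\<Sum>b\<in>opp p. card (b \<inter> nb p) choose 2) + card (irr p) = 12"
proof -
  have k: "(card (b \<inter> nb p) choose 2) + of_bool (b \<in> irr p) = card (b \<inter> nb p)"
    if "b \<in> opp p" for b
  proof -
    have "card (b \<inter> nb p) \<in> {0, 1, 2, 3}" using card_inter_le[OF that] by auto
    then show ?thesis using that by (auto simp: irr_def choose_two)
  qed
  have "card (irr p) = (\<Sum>b\<in>opp p. of_bool (b \<in> irr p))"
  proof -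
    have "irr p = {b \<in> opp p. b \<in> irr p}" by (auto simp: irr_def)
    then show ?thesis using finite_opp by (simp add: Int_def)
  qed
  then have "(\<Sum>b\<in>opp p. card (b \<inter> nb p) choose 2) + card (irr p)
      = (\<Sum>b\<in>opp p. (card (b \<inter> nb p) choose 2) + of_bool (b \<in> irr p))"
    by (simp add: sum.distrib)
  also have "\<dots> = 12" using k sum_card_nb[OF assms] by simp
  finally show ?thesis .
qed

section \<open>Counting triangles by a vertex and its opposite side\<close>

definition pairs :: "'a \<Rightarrow> 'a set \<Rightarrow> 'a set set" where
  "pairs p b = {e. e \<subseteq> b \<inter> nb p \<and> card e = 2}"

text \<open>A code consists of a vertex \<open>p\<close>, the side \<open>b\<close> opposite to it,
  and the pair of the two remaining vertices, which lie on \<open>b\<close>.\<close>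

definition triangle_codes :: "('a \<times> 'a set \<times> 'a set) set" where
  "triangle_codes = (SIGMA p:P. SIGMA b:opp p. pairs p b)"

text \<open>The sides through \<open>p\<close> are recovered as the blocks joining \<open>p\<close>
  to a point of \<open>e\<close>. The side \<open>b\<close> is kept as a mark, so that each triangle
  is reached once for each of its three sides.\<close>

definition decode :: "'a \<times> 'a set \<times> 'a set \<Rightarrow> 'a set set \<times> 'a set" where
  "decode = (\<lambda>(p, b, e). (insert b {b' \<in> B. p \<in> b' \<and> b' \<inter> e \<noteq> {}}, b))"

lemma finite_pairs: "finite (pairs p b)"
  by (rule finite_subset[of _ "Pow (nb p)"]) (auto simp: pairs_def finite_nb)

lemma card_pairs: "card (pairs p b) = card (b \<inter> nb p) choose 2"
  unfolding pairs_def by (rule n_subsets) (simp add: finite_nb)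

lemma finite_triangle_codes: "finite triangle_codes"
  unfolding triangle_codes_def
  by (intro finite_SigmaI finite_points finite_opp finite_pairs)

lemma card_triangle_codes:
  "card triangle_codes = (\<Sum>p\<in>P. \<Sum>b\<in>opp p. card (b \<inter> nb p) choose 2)"
  unfolding triangle_codes_def
  by (simp add: finite_points finite_opp finite_pairs finite_SigmaI card_pairs)

lemma triangle_in_decode:
  assumes "{a, b, f} \<in> B" "{a, c, e} \<in> B" "{b, c, d} \<in> B" "distinct [a, b, c, d, e, f]"
  shows "({{a, b, f}, {a, c, e}, {b, c, d}}, {b, c, d}) \<in> decode ` triangle_codes"
proof
  have eq: "{b' \<in> B. a \<in> b' \<and> b' \<inter> {b, c} \<noteq> {}} = {{a, b, f}, {a, c, e}}"
  proof -
    have "x = {a, b, f}" if "x \<in> B" "a \<in> x" "b \<in> x" for x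
      using that assms by (intro block_eqI[of _ _ a b]) auto
    moreover have "x = {a, c, e}" if "x \<in> B" "a \<in> x" "c \<in> x" for x
      using that assms by (intro block_eqI[of _ _ a c]) auto
    ultimately have "x \<in> {{a, b, f}, {a, c, e}}" if "x \<in> B" "a \<in> x" "x \<inter> {b, c} \<noteq> {}" for x
      using that by blast
    then show ?thesis using assms by blast
  qed
  show "({{a, b, f}, {a, c, e}, {b, c, d}}, {b, c, d}) = decode (a, {b, c, d}, {b, c})"
    unfolding decode_def split_conv eq by (simp only: insert_commute)
  have "b \<in> nb a" "c \<in> nb a"
    unfolding nb_def using assms by auto
  moreover have "a \<in> P" using assms block_subset by auto
  ultimately show "(a, {b, c, d}, {b, c}) \<in> triangle_codes"
    using assms by (auto simp: triangle_codes_def pairs_def opp_def)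
qed

text \<open>By the symmetry of a triangle in its vertices, each side can take the role of
  \<open>{b, c, d}\<close> in \<open>triangle_in_decode\<close> after relabelling.\<close>

lemma triangle_flag_in_decode:
  assumes "triangle B S" "l \<in> S"
  shows "(S, l) \<in> decode ` triangle_codes"
proof -
  obtain a b c d e f where *: "distinct [a, b, c, d, e, f]" "S \<subseteq> B"
    "S = {{a, b, f}, {a, c, e}, {b, c, d}}"
    using assms(1) unfolding triangle_def by (elim conjE exE) (rule that)
  have B: "{a, b, f} \<in> B" "{a, c, e} \<in> B" "{b, c, d} \<in> B" using *(2,3) by blast+
  consider "l = {a, b, f}" | "l = {a, c, e}" | "l = {b, c, d}"
    using assms(2) unfolding *(3) by blast
  then show ?thesis
  proof cases
    case 1
    have "({{c, a, e}, {c, b, d}, {a, b, f}}, {a, b, f}) \<in> decode ` triangle_codes"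
      using B *(1) by (intro triangle_in_decode) (simp_all only: insert_commute, auto)
    moreover have "{{c, a, e}, {c, b, d}, {a, b, f}} = S"
      unfolding *(3) by (simp only: insert_commute)
    ultimately show ?thesis by (simp only: 1)
  next
    case 2
    have "({{b, a, f}, {b, c, d}, {a, c, e}}, {a, c, e}) \<in> decode ` triangle_codes"
      using B *(1) by (intro triangle_in_decode) (simp_all only: insert_commute, auto)
    moreover have "{{b, a, f}, {b, c, d}, {a, c, e}} = S"
      unfolding *(3) by (simp only: insert_commute)
    ultimately show ?thesis by (simp only: 2)
  next
    case 3
    then show ?thesis using triangle_in_decode[OF B *(1)] by (simp only: *(3))
  qed
qed

lemma card_triangle:
  assumes "triangle C S"
  shows "card S = 3"
proof -
  obtain a b c d e f where *: "distinct [a, b, c, d, e, f]"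
    "S = {{a, b, f}, {a, c, e}, {b, c, d}}"
    using assms unfolding triangle_def by (elim conjE exE) (rule that)
  have "{a, b, f} \<noteq> {a, c, e}" "{a, b, f} \<noteq> {b, c, d}" "{a, c, e} \<noteq> {b, c, d}"
    using *(1) by auto
  then show ?thesis using *(2) by simp
qed

text \<open>Each triangle has three marked versions and \<open>decode\<close> reaches all of them,
  so three times the number of triangles is at most the number of codes. By
  \<open>sum_choose\<close> the codes at \<open>p\<close> number
  \<open>12 - card (irr p)\<close>.\<close>

lemma triangles_irr:
  "3 * num_triangles B + (\<Sum>p\<in>P. card (irr p)) \<le> 12 * v"
proof -
  have fin: "finite {S. triangle B S}"
    by (rule finite_subset[of _ "Pow B"]) (auto simp: triangle_def finite_blocks)
  have "3 * num_triangles B = card (SIGMA S:{S. triangle B S}. S)"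
  proof -
    have "\<forall>S\<in>{S. triangle B S}. finite S"
      using card_triangle card.infinite by fastforce
    then have "card (SIGMA S:{S. triangle B S}. S) = (\<Sum>S\<in>{S. triangle B S}. card S)"
      using fin by (intro card_SigmaI)
    also have "\<dots> = (\<Sum>S\<in>{S. triangle B S}. 3)"
      by (rule sum.cong) (simp_all add: card_triangle)
    finally show ?thesis by (simp add: num_triangles_def)
  qed
  also have "\<dots> \<le> card (decode ` triangle_codes)"
    using triangle_flag_in_decode by (intro card_mono finite_imageI finite_triangle_codes) auto
  also have "\<dots> \<le> (\<Sum>p\<in>P. \<Sum>b\<in>opp p. card (b \<inter> nb p) choose 2)"
    using card_image_le[OF finite_triangle_codes] card_triangle_codes by metis
  finally have "3 * num_triangles B + (\<Sum>p\<in>P. card (irr p))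
    \<le> (\<Sum>p\<in>P. (\<Sum>b\<in>opp p. card (b \<inter> nb p) choose 2) + card (irr p))"
    by (simp add: sum.distrib)
  also have "\<dots> = 12 * v" using sum_choose card_points by simp
  finally show ?thesis .
qed

section \<open>Closed point sets and connectedness\<close>

text \<open>Points of \<open>Q\<close> keep their whole pencils, so counting incidences in two ways
  gives as many blocks inside \<open>Q\<close> as points.\<close>

lemma closed_sub_configuration:
  assumes Q: "Q \<subseteq> P" and closed: "\<And>b. b \<in> B \<Longrightarrow> b \<inter> Q \<noteq> {} \<Longrightarrow> b \<subseteq> Q"
  shows "sym_configuration (card Q) Q {b \<in> B. b \<subseteq> Q}"
proof -
  have finQ: "finite Q" using Q finite_points finite_subset by blast
  have pen: "{b \<in> {b \<in> B. b \<subseteq> Q}. p \<in> b} = pencil p" if "p \<in> Q" for p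
    using closed that by (auto simp: pencil_def)
  have "(\<Sum>b\<in>{b \<in> B. b \<subseteq> Q}. card {q \<in> Q. q \<in> b}) = (\<Sum>q\<in>Q. 3)"
    using finQ finite_blocks pen Q by (intro sum_multicount_gen) (auto simp: card_pencil subset_iff)
  moreover have "card {q \<in> Q. q \<in> b} = 3" if "b \<in> {b \<in> B. b \<subseteq> Q}" for b
  proof -
    have "{q \<in> Q. q \<in> b} = b" using that by auto
    then show ?thesis using that card_block by auto
  qed
  ultimately have "card {b \<in> B. b \<subseteq> Q} = card Q" by simp
  moreover have "card {b \<in> {b \<in> B. b \<subseteq> Q}. p \<in> b \<and> q \<in> b} \<le> 1" if "p \<noteq> q" for p q
  proof -
    have "finite {b \<in> {b \<in> B. b \<subseteq> Q}. p \<in> b \<and> q \<in> b}" using finite_blocks by auto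
    then show ?thesis using that block_eqI by (auto simp: card_le_Suc0_iff_eq)
  qed
  ultimately show ?thesis
    using finQ finite_blocks card_block pen Q
    by (auto simp: sym_configuration_def card_pencil subset_iff)
qed

text \<open>The complement of a closed set is closed as well, so both sides carry symmetric
  configurations.\<close>

lemma closed_decomposable:
  assumes Q: "Q \<subseteq> P" "Q \<noteq> {}" "Q \<noteq> P"
    and closed: "\<And>b. b \<in> B \<Longrightarrow> b \<inter> Q \<noteq> {} \<Longrightarrow> b \<subseteq> Q"
  shows "decomposable P B"
proof -
  have c: "b \<subseteq> P - Q" if "b \<in> B" "b \<inter> (P - Q) \<noteq> {}" for b
    using that closed[of b] block_subset[of b] by auto
  have ne: "b \<noteq> {}" if "b \<in> B" for b using card_block that by force
  have "B = {b \<in> B. b \<subseteq> Q} \<union> {b \<in> B. b \<subseteq> P - Q}"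
  proof -
    have "b \<subseteq> Q \<or> b \<subseteq> P - Q" if "b \<in> B" for b
      using closed[OF that] block_subset[OF that] by auto
    then show ?thesis by blast
  qed
  moreover have "sym_configuration (card Q) Q {b \<in> B. b \<subseteq> Q}"
    using Q closed by (intro closed_sub_configuration)
  moreover have "sym_configuration (card (P - Q)) (P - Q) {b \<in> B. b \<subseteq> P - Q}"
    using c by (intro closed_sub_configuration) auto
  moreover have "0 < card Q" "0 < card (P - Q)"
    using Q finite_points finite_subset by (auto simp: card_gt_0_iff)
  moreover have "Q \<inter> (P - Q) = {}" "P = Q \<union> (P - Q)" using Q by auto
  ultimately show ?thesis unfolding decomposable_def by metis
qed

text \<open>Otherwise every block that avoids \<open>p\<close> and meets \<open>nb p\<close> lies
  inside it, so the seven points \<open>insert p (nb p)\<close> form a closed set, which is proper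
  because \<open>v \<ge> 8\<close>.\<close>

lemma irr_nonempty:
  assumes "\<not> decomposable P B" "v \<ge> 8" "p \<in> P"
  shows "irr p \<noteq> {}"
proof
  assume e: "irr p = {}"
  let ?Q = "insert p (nb p)"
  have "card ?Q = 7" using card_nb[OF assms(3)] finite_nb by (simp add: nb_def)
  then have "?Q \<noteq> P" using card_points assms by auto
  moreover have "?Q \<subseteq> P" using nb_subset assms by auto
  moreover have "b \<subseteq> ?Q" if b: "b \<in> B" "b \<inter> ?Q \<noteq> {}" for b
  proof (cases "p \<in> b")
    case True
    then show ?thesis using b by (auto simp: nb_def)
  next
    case False
    then have o: "b \<in> opp p" using b by (auto simp: opp_def)
    have "b \<inter> nb p \<noteq> {}" using b False by auto
    then have "card (b \<inter> nb p) \<noteq> 0" using finite_nb by simp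
    moreover have "card (b \<inter> nb p) \<notin> {1, 2}" using e o by (auto simp: irr_def)
    ultimately have "card (b \<inter> nb p) = card b"
      using card_inter_le[OF o] card_block[OF b(1)] by auto
    then have "b \<inter> nb p = b" using finite_block[OF b(1)] by (intro card_subset_eq) auto
    then show ?thesis by auto
  qed
  ultimately show False using closed_decomposable[of ?Q] assms(1) by blast
qed

definition full :: "'a \<Rightarrow> 'a set set" where
  "full p = {b \<in> opp p. card (b \<inter> nb p) = 3}"

lemma irrD: "b \<in> irr p \<Longrightarrow> b \<in> opp p" "b \<in> irr p \<Longrightarrow> b \<notin> full p"
  by (auto simp: irr_def full_def)

lemma fullD: "b \<in> full p \<Longrightarrow> b \<in> opp p"
  by (auto simp: full_def)

lemma oppD: "b \<in> opp p \<Longrightarrow> b \<in> B" "b \<in> opp p \<Longrightarrow> p \<notin> b"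
  by (auto simp: opp_def)

lemma finite_full: "finite (full p)"
  using finite_opp by (auto simp: full_def)

lemma card_full:
  assumes "p \<in> P"
  shows "3 * card (full p) + (\<Sum>b\<in>irr p. card (b \<inter> nb p)) = 12"
proof -
  have "(\<Sum>b\<in>opp p. card (b \<inter> nb p)) = (\<Sum>b\<in>full p \<union> irr p. card (b \<inter> nb p))"
  proof (rule sum.mono_neutral_right)
    show "\<forall>b\<in>opp p - (full p \<union> irr p). card (b \<inter> nb p) = 0"
    proof
      fix b assume b: "b \<in> opp p - (full p \<union> irr p)"
      then have "card (b \<inter> nb p) \<le> 3" using card_inter_le by auto
      then show "card (b \<inter> nb p) = 0" using b by (auto simp: full_def irr_def)
    qed
  qed (use finite_opp in \<open>auto simp: full_def irr_def\<close>)
  also have "\<dots> = (\<Sum>b\<in>full p. card (b \<inter> nb p)) + (\<Sum>b\<in>irr p. card (b \<inter> nb p))"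
    by (rule sum.union_disjoint[OF finite_full finite_irr]) (auto simp: full_def irr_def)
  also have "(\<Sum>b\<in>full p. card (b \<inter> nb p)) = 3 * card (full p)"
    by (simp add: full_def)
  finally show ?thesis using sum_card_nb[OF assms] by simp
qed

lemma card_irr_ge_2:
  assumes "\<not> decomposable P B" "v \<ge> 8" "p \<in> P"
  shows "2 \<le> card (irr p)"
proof (rule ccontr)
  assume "\<not> ?thesis"
  moreover have "card (irr p) \<noteq> 0" using irr_nonempty[OF assms] finite_irr by simp
  ultimately have "card (irr p) = 1" by simp
  then obtain b where b: "irr p = {b}" by (auto simp: card_1_singleton_iff)
  then have "card (b \<inter> nb p) = 1 \<or> card (b \<inter> nb p) = 2" by (auto simp: irr_def)
  moreover have "3 * card (full p) + card (b \<inter> nb p) = 12" using card_full[OF assms(3)] b by simp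
  ultimately show False by presburger
qed

text \<open>The two intersection sizes lie in \<open>{1, 2}\<close> and their sum is divisible by 3,
  so they are 1 and 2; the remaining 9 incidences fill three blocks.\<close>

lemma irr_two:
  assumes "p \<in> P" "card (irr p) = 2"
  obtains b c where "irr p = {b, c}" "b \<noteq> c" "card (b \<inter> nb p) = 2" "card (c \<inter> nb p) = 1"
    "card (full p) = 3"
proof -
  obtain b c where bc: "irr p = {b, c}" "b \<noteq> c" using assms(2) by (auto simp: card_2_iff)
  have "card (b \<inter> nb p) = 1 \<or> card (b \<inter> nb p) = 2" "card (c \<inter> nb p) = 1 \<or> card (c \<inter> nb p) = 2"
    using bc by (auto simp: irr_def)
  moreover have "3 * card (full p) + (card (b \<inter> nb p) + card (c \<inter> nb p)) = 12"
    using card_full[OF assms(1)] bc by simp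
  ultimately have "card (full p) = 3 \<and> (card (b \<inter> nb p) = 2 \<and> card (c \<inter> nb p) = 1 \<or>
     card (c \<inter> nb p) = 2 \<and> card (b \<inter> nb p) = 1)"
    by presburger
  then show ?thesis using bc that[of b c] that[of c b] by (auto simp: insert_commute)
qed

lemma block_insert3:
  assumes "b \<in> B" "p \<in> b" "q \<in> b" "p \<noteq> q"
  obtains r where "b = {p, q, r}" "r \<noteq> p" "r \<noteq> q"
proof -
  have "card (b - {p, q}) = 1" using assms card_block by simp
  then obtain r where "b - {p, q} = {r}" by (auto simp: card_1_singleton_iff)
  then have "b = {p, q, r}" "r \<noteq> p" "r \<noteq> q" using assms by auto
  then show ?thesis by (rule that)
qed

lemma block_eq3:
  assumes "b \<in> B" "p \<in> b" "q \<in> b" "r \<in> b" "p \<noteq> q" "p \<noteq> r" "q \<noteq> r"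
  shows "b = {p, q, r}"
proof -
  obtain s where "b = {p, q, s}" using block_insert3[of b p q] assms by blast
  then show ?thesis using assms by auto
qed

lemma nbI: "b \<in> B \<Longrightarrow> p \<in> b \<Longrightarrow> q \<in> b \<Longrightarrow> q \<noteq> p \<Longrightarrow> q \<in> nb p"
  by (auto simp: nb_def)

lemma nb_line:
  assumes "q \<in> nb p"
  obtains r where "{p, q, r} \<in> B" "r \<noteq> p" "r \<noteq> q" "q \<noteq> p"
proof -
  obtain l where l: "l \<in> B" "p \<in> l" "q \<in> l" "q \<noteq> p" using assms by (auto simp: nb_def)
  obtain r where "l = {p, q, r}" "r \<noteq> p" "r \<noteq> q" using block_insert3[OF l(1-3)] l(4) by auto
  then show ?thesis using l that by auto
qed

section \<open>Local structure at a point with two irregular blocks\<close>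

text \<open>All three points of \<open>f\<close> lie on blocks through \<open>p\<close>, and each of
  these three blocks contains at most one of them, so none can be missed.\<close>

lemma full_meets_pencil:
  assumes "p \<in> P" "f \<in> full p" "l \<in> pencil p"
  shows "f \<inter> l \<noteq> {}"
proof
  assume e: "f \<inter> l = {}"
  have f: "f \<in> B" "p \<notin> f" "card (f \<inter> nb p) = 3" using assms by (auto simp: full_def opp_def)
  then have fnb: "f \<inter> nb p = f" by (intro card_subset_eq finite_block) (auto simp: card_block)
  have "f \<subseteq> (\<Union>l'\<in>pencil p - {l}. f \<inter> l')"
  proof
    fix q assume q: "q \<in> f"
    then have "q \<in> nb p" using fnb by blast
    then obtain l' where "l' \<in> B" "p \<in> l'" "q \<in> l'" by (auto simp: nb_def)
    moreover from this have "l' \<noteq> l" using e q by blast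
    ultimately show "q \<in> (\<Union>l'\<in>pencil p - {l}. f \<inter> l')" using q by (auto simp: pencil_def)
  qed
  then have "card f \<le> card (\<Union>l'\<in>pencil p - {l}. f \<inter> l')"
    by (intro card_mono finite_UN_I) (auto simp: finite_pencil finite_block f)
  also have "\<dots> \<le> (\<Sum>l'\<in>pencil p - {l}. card (f \<inter> l'))"
    by (rule card_UN_le) (simp add: finite_pencil)
  also have "\<dots> \<le> (\<Sum>l'\<in>pencil p - {l}. 1)"
  proof (rule sum_mono)
    fix l' assume l': "l' \<in> pencil p - {l}"
    have "x = y" if "x \<in> f \<inter> l'" "y \<in> f \<inter> l'" for x y
      using block_eqI[of f l' x y] that l' f by (auto simp: pencil_def)
    then show "card (f \<inter> l') \<le> 1"
      using finite_block[OF f(1)] by (auto simp: card_le_Suc0_iff_eq)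
  qed
  also have "\<dots> = 2" using card_pencil[OF assms(1)] assms(3) finite_pencil by simp
  finally show False using card_block[OF f(1)] by simp
qed

lemma opp_cases:
  assumes "b \<in> opp p" "q \<in> b" "q \<in> nb p"
  shows "b \<in> full p \<or> b \<in> irr p"
proof -
  have "card (b \<inter> nb p) \<noteq> 0" using assms finite_nb by auto
  then show ?thesis using card_inter_le[OF assms(1)] assms(1) by (auto simp: full_def irr_def)
qed

text \<open>The two points of \<open>l\<close> other than \<open>p\<close> lie on at most four
  blocks avoiding \<open>p\<close>. The three full blocks all meet \<open>l\<close>, so if
  \<open>b\<close> and \<open>c\<close> both did too, there would be five.\<close>

lemma irr_meets_once:
  assumes p: "p \<in> P" and irr: "irr p = {b, c}" "b \<noteq> c" and full: "card (full p) = 3"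
    and l: "l \<in> pencil p" "b \<inter> l \<noteq> {}"
  shows "c \<inter> l = {}"
proof (rule ccontr)
  assume c: "c \<inter> l \<noteq> {}"
  have lB: "l \<in> B" "p \<in> l" using l by (auto simp: pencil_def)
  have "card (l - {p}) = 2" using lB card_block by simp
  then obtain q r where qr: "l - {p} = {q, r}" by (auto simp: card_2_iff)
  have nb: "q \<in> nb p" "r \<in> nb p" using qr lB by (auto simp: nb_def)
  have opp: "g \<in> opp p" if "g \<in> insert b (insert c (full p))" for g
    using that irrD(1)[of _ p] fullD unfolding irr(1) by blast
  have "insert b (insert c (full p)) \<subseteq> {g \<in> opp p. q \<in> g} \<union> {g \<in> opp p. r \<in> g}"
  proof (rule subsetI)
    fix g assume g: "g \<in> insert b (insert c (full p))"
    then have "g \<inter> l \<noteq> {}" using full_meets_pencil[OF p _ l(1)] c l(2) by blast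
    then obtain m where m: "m \<in> g" "m \<in> l" by blast
    have "p \<notin> g" using opp[OF g] by (auto simp: opp_def)
    then have "m \<in> l - {p}" using m by auto
    then have "q \<in> g \<or> r \<in> g" using m unfolding qr by auto
    then show "g \<in> {g \<in> opp p. q \<in> g} \<union> {g \<in> opp p. r \<in> g}" using opp[OF g] by auto
  qed
  then have "card (insert b (insert c (full p))) \<le> card ({g \<in> opp p. q \<in> g} \<union> {g \<in> opp p. r \<in> g})"
    by (intro card_mono) (auto simp: finite_opp)
  also have "\<dots> \<le> 4"
    using card_Un_le[of "{g \<in> opp p. q \<in> g}" "{g \<in> opp p. r \<in> g}"] card_opp_through nb by simp
  finally have "card (insert b (insert c (full p))) \<le> 4" .
  moreover have "b \<notin> full p" "c \<notin> full p" using irrD(2)[of _ p] unfolding irr(1) by auto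
  ultimately show False using full irr(2) finite_full by simp
qed

text \<open>Besides \<open>b\<close>, only one block \<open>f\<close> through \<open>q\<close>
  avoids \<open>p\<close>. It is not \<open>c\<close>, which misses this line, so it is full. The
  other full blocks meet the line too and hence pass through \<open>r\<close>, while
  \<open>f\<close> cannot contain both \<open>q\<close> and \<open>r\<close>.\<close>

lemma irr_partner:
  assumes p: "p \<in> P" and irr: "irr p = {b, c}" "b \<noteq> c" and full: "card (full p) = 3"
    and l: "{p, q, r} \<in> B" "q \<noteq> p" "r \<noteq> p" "q \<noteq> r" and q: "q \<in> b"
  shows "\<exists>f\<in>full p. \<forall>g\<in>full p. (q \<in> g \<longleftrightarrow> g = f) \<and> (r \<in> g \<longleftrightarrow> g \<noteq> f)"
proof -
  have lp: "{p, q, r} \<in> pencil p" using l by (auto simp: pencil_def)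
  have c: "q \<notin> c" using irr_meets_once[OF p irr full lp] q by auto
  have nb: "q \<in> nb p" "r \<in> nb p" using l unfolding nb_def by auto
  have bi: "b \<in> irr p" using irr by simp
  note b = irrD(1)[OF bi] and bf = irrD(2)[OF bi]
  have "b \<in> {g \<in> opp p. q \<in> g}" using b q by auto
  then have "card ({g \<in> opp p. q \<in> g} - {b}) = 1" using card_opp_through[OF nb(1)] by simp
  then obtain f where f: "{g \<in> opp p. q \<in> g} - {b} = {f}" by (auto simp: card_1_singleton_iff)
  then have f': "f \<in> opp p" "q \<in> f" "f \<noteq> b" by auto
  then have "f \<noteq> c" using c by auto
  then have ff: "f \<in> full p" using opp_cases[OF f'(1,2) nb(1)] f'(3) unfolding irr(1) by auto
  have q_iff: "q \<in> g \<longleftrightarrow> g = f" if g: "g \<in> full p" for g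
  proof -
    have "g \<in> opp p" "g \<noteq> b" using g bf fullD by auto
    then show ?thesis using f by blast
  qed
  have r_iff: "r \<in> g \<longleftrightarrow> g \<noteq> f" if g: "g \<in> full p" for g
  proof -
    have gB: "g \<in> B" "p \<notin> g" using fullD[OF g] oppD by auto
    have "\<not> (q \<in> g \<and> r \<in> g)" using block_eqI[OF l(1) gB(1), of q r] l gB(2) by auto
    moreover have "q \<in> g \<or> r \<in> g" using full_meets_pencil[OF p g lp] gB(2) by auto
    ultimately show ?thesis using q_iff[OF g] by auto
  qed
  show ?thesis using q_iff r_iff by (intro bexI[OF _ ff] ballI conjI)
qed

text \<open>The Fano plane on \<open>p, p1, p2, p3, x, y, z\<close> without its line \<open>{x, y, z}\<close>; the third block
  through \<open>z\<close> leaves the plane.\<close>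

definition cluster :: "'a \<Rightarrow> 'a \<Rightarrow> 'a \<Rightarrow> 'a \<Rightarrow> 'a \<Rightarrow> 'a \<Rightarrow> 'a \<Rightarrow> 'a \<Rightarrow> 'a \<Rightarrow> bool" where
  "cluster p p1 p2 p3 x y z u t \<longleftrightarrow> distinct [p, p1, p2, p3, x, y, z, u, t] \<and>
     {p, x, p1} \<in> B \<and> {p, y, p2} \<in> B \<and> {p, z, p3} \<in> B \<and>
     {x, p2, p3} \<in> B \<and> {y, p1, p3} \<in> B \<and> {z, p1, p2} \<in> B \<and> {z, u, t} \<in> B"

text \<open>The points \<open>x\<close>, \<open>y\<close> are the neighbours of \<open>p\<close> on
  one irregular block, \<open>z\<close> is the one on the other, and \<open>p1\<close>,
  \<open>p2\<close>, \<open>p3\<close> complete their lines through \<open>p\<close>. By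
  \<open>irr_partner\<close> each of \<open>x\<close>, \<open>y\<close>, \<open>z\<close> lies on
  one full block and its partner on the other two; these three full blocks turn out to be distinct,
  which determines them.\<close>

lemma cluster_exists:
  assumes p: "p \<in> P" and irr2: "card (irr p) = 2"
  shows "\<exists>p1 p2 p3 x y z u t. cluster p p1 p2 p3 x y z u t"
proof -
  obtain b c where bc: "irr p = {b, c}" "b \<noteq> c" "card (b \<inter> nb p) = 2" "card (c \<inter> nb p) = 1"
    and full: "card (full p) = 3"
    using irr_two[OF p irr2] by metis
  have cb: "irr p = {c, b}" using bc by auto
  have B: "b \<in> B" "c \<in> B" "p \<notin> b" "p \<notin> c"
    using oppD[OF irrD(1), of _ p] unfolding bc(1) by auto
  obtain x y where xy: "b \<inter> nb p = {x, y}" "x \<noteq> y" using bc(3) by (auto simp: card_2_iff)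
  obtain z where z: "c \<inter> nb p = {z}" using bc(4) by (auto simp: card_1_singleton_iff)
  have nb: "x \<in> nb p" "y \<in> nb p" "z \<in> nb p" "x \<in> b" "y \<in> b" "z \<in> c" using xy z by auto
  obtain p1 where p1: "{p, x, p1} \<in> B" "p1 \<noteq> p" "p1 \<noteq> x" "x \<noteq> p" using nb_line[OF nb(1)] .
  obtain p2 where p2: "{p, y, p2} \<in> B" "p2 \<noteq> p" "p2 \<noteq> y" "y \<noteq> p" using nb_line[OF nb(2)] .
  obtain p3 where p3: "{p, z, p3} \<in> B" "p3 \<noteq> p" "p3 \<noteq> z" "z \<noteq> p" using nb_line[OF nb(3)] .
  have pen: "{p, x, p1} \<in> pencil p" "{p, y, p2} \<in> pencil p"
    using p1 p2 by (auto simp: pencil_def)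
  have "c \<inter> {p, x, p1} = {}" "c \<inter> {p, y, p2} = {}"
    using irr_meets_once[OF p bc(1,2) full pen(1)] irr_meets_once[OF p bc(1,2) full pen(2)] nb
    by auto
  then have zne: "z \<notin> {p, x, p1}" "z \<notin> {p, y, p2}" using nb by auto
  have yne: "y \<notin> {p, x, p1}"
    using block_eqI[OF p1(1) B(1), of x y] nb xy(2) B(3) by auto
  have inter: "l \<inter> l' = {p}" if "l \<in> B" "l' \<in> B" "p \<in> l" "p \<in> l'" "l \<noteq> l'" for l l'
    using block_eqI[of l l' p] that by blast
  have "{p, x, p1} \<inter> {p, y, p2} = {p}" "{p, x, p1} \<inter> {p, z, p3} = {p}"
    "{p, y, p2} \<inter> {p, z, p3} = {p}"
    using p1 p2 p3 yne zne by (intro inter; force)+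
  then have "x \<notin> {p, y, p2}" "x \<notin> {p, z, p3}" "y \<notin> {p, z, p3}" "p1 \<notin> {p, y, p2}" "p1 \<notin> {p, z, p3}"
    "p2 \<notin> {p, z, p3}"
    using p1 p2 p3 by blast+
  then have dist: "distinct [p, p1, p2, p3, x, y, z]"
    using p1(2-) p2(2-) p3(2-) zne yne by auto
  obtain fx where fx: "fx \<in> full p" "\<And>g. g \<in> full p \<Longrightarrow> x \<in> g \<longleftrightarrow> g = fx"
    "\<And>g. g \<in> full p \<Longrightarrow> p1 \<in> g \<longleftrightarrow> g \<noteq> fx"
    using irr_partner[OF p bc(1,2) full p1(1,4,2) p1(3)[symmetric] nb(4)] by blast
  obtain fy where fy: "fy \<in> full p" "\<And>g. g \<in> full p \<Longrightarrow> y \<in> g \<longleftrightarrow> g = fy"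
    "\<And>g. g \<in> full p \<Longrightarrow> p2 \<in> g \<longleftrightarrow> g \<noteq> fy"
    using irr_partner[OF p bc(1,2) full p2(1,4,2) p2(3)[symmetric] nb(5)] by blast
  obtain fz where fz: "fz \<in> full p" "\<And>g. g \<in> full p \<Longrightarrow> z \<in> g \<longleftrightarrow> g = fz"
    "\<And>g. g \<in> full p \<Longrightarrow> p3 \<in> g \<longleftrightarrow> g \<noteq> fz"
    using irr_partner[OF p cb bc(2)[symmetric] full p3(1,4,2) p3(3)[symmetric] nb(6)] by blast
  have fullB: "g \<in> B" if "g \<in> full p" for g using that by (intro oppD fullD)
  \<comment> \<open>A full block through both \<open>x\<close> and \<open>y\<close> would coincide
    with the irregular block \<open>b\<close>.\<close>
  have "b \<notin> full p" using irrD(2)[of _ p] unfolding bc(1) by auto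
  then have fxy: "fx \<noteq> fy"
    using block_eqI[OF fullB[OF fx(1)] B(1), of x y] fx fy nb xy(2) by auto
  have two: "\<exists>g h. g \<in> full p \<and> h \<in> full p \<and> g \<noteq> h \<and> g \<noteq> f \<and> h \<noteq> f" if "f \<in> full p" for f
  proof -
    have "card (full p - {f}) = 2" using full that finite_full by simp
    then obtain g h where "full p - {f} = {g, h}" "g \<noteq> h" by (auto simp: card_2_iff)
    then show ?thesis by blast
  qed
  \<comment> \<open>If they were equal, the two other full blocks would both contain
    \<open>p1\<close> and \<open>p3\<close> and hence coincide.\<close>
  have fxz: "fx \<noteq> fz"
  proof
    assume e: "fx = fz"
    obtain g h where gh: "g \<in> full p" "h \<in> full p" "g \<noteq> h" "g \<noteq> fx" "h \<noteq> fx"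
      using two[OF fx(1)] by blast
    then have "g = h"
      using e fx fz dist by (intro block_eqI[of g h p1 p3] fullB) auto
    then show False using gh by auto
  qed
  have fyz: "fy \<noteq> fz"
  proof
    assume e: "fy = fz"
    obtain g h where gh: "g \<in> full p" "h \<in> full p" "g \<noteq> h" "g \<noteq> fy" "h \<noteq> fy"
      using two[OF fy(1)] by blast
    then have "g = h"
      using e fy fz dist by (intro block_eqI[of g h p2 p3] fullB) auto
    then show False using gh by auto
  qed
  \<comment> \<open>Being different from \<open>fy\<close> and \<open>fz\<close>, the block
    \<open>fx\<close> contains the partners \<open>p2\<close> and \<open>p3\<close>.\<close>
  have "fx = {x, p2, p3}"
    using fx fy fz fxy fxz dist by (intro block_eq3 fullB) auto
  then have X: "{x, p2, p3} \<in> B" using fullB fx(1) by auto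
  have "fy = {y, p1, p3}"
    using fx fy fz fxy fyz dist by (intro block_eq3 fullB) auto
  then have Y: "{y, p1, p3} \<in> B" using fullB fy(1) by auto
  have "fz = {z, p1, p2}"
    using fx fy fz fxz fyz dist by (intro block_eq3 fullB) auto
  then have Z: "{z, p1, p2} \<in> B" using fullB fz(1) by auto
  have "card (c - {z}) = 2" using B(2) nb card_block by simp
  then obtain u t where ut: "c - {z} = {u, t}" "u \<noteq> t" by (auto simp: card_2_iff)
  have c: "c = {z, u, t}" using ut nb by auto
  have "p1 \<in> nb p" "p2 \<in> nb p" "p3 \<in> nb p"
    using nbI[OF p1(1)] nbI[OF p2(1)] nbI[OF p3(1)] p1(2) p2(2) p3(2) by simp_all
  then have "{p1, p2, p3, x, y} \<subseteq> nb p" using nb by simp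
  \<comment> \<open>The block \<open>c\<close> avoids \<open>p\<close> and has \<open>z\<close> as
    its only neighbour of \<open>p\<close>, so its other two points are new.\<close>
  then have "{u, t} \<inter> {p, p1, p2, p3, x, y, z} = {}"
    using ut(1) z B(4) by blast
  then have "distinct [p, p1, p2, p3, x, y, z, u, t]" using dist ut(2) by auto
  then have "cluster p p1 p2 p3 x y z u t"
    unfolding cluster_def using p1(1) p2(1) p3(1) X Y Z B(2) c by (intro conjI) simp_all
  then show ?thesis by (intro exI)
qed

section \<open>Irregular blocks at the charged point of a cluster\<close>

text \<open>The points \<open>q\<close> and \<open>r\<close> serve as witnesses that the three
  blocks are distinct, and a pencil has only three.\<close>

lemma pencil_eq:
  assumes "a \<in> B" "b \<in> B" "c \<in> B" "p \<in> a" "p \<in> b" "p \<in> c"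
    and "q \<in> a" "q \<notin> b" "q \<notin> c" "r \<in> b" "r \<notin> c"
  shows "pencil p = {a, b, c}"
proof -
  have "{a, b, c} \<subseteq> pencil p" using assms by (simp add: pencil_def)
  moreover have "card {a, b, c} = 3"
  proof -
    have "a \<noteq> b" "a \<noteq> c" "b \<noteq> c" using assms by metis+
    then show ?thesis by simp
  qed
  moreover have "p \<in> P" using assms(1,4) block_subset by blast
  ultimately show ?thesis
    using card_subset_eq[OF finite_pencil] card_pencil by metis
qed

lemma nb_eq: "nb p = \<Union> (pencil p) - {p}"
  by (auto simp: nb_def pencil_def)

text \<open>The seven listed blocks exhaust the pencils of all cluster points except
  \<open>x\<close>, \<open>y\<close>, \<open>u\<close> and \<open>t\<close>.\<close>

lemma cluster_pencils:
  assumes "cluster p p1 p2 p3 x y z u t"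
  shows "pencil p = {{p, x, p1}, {p, y, p2}, {p, z, p3}}"
    "pencil p1 = {{p, x, p1}, {y, p1, p3}, {z, p1, p2}}"
    "pencil p2 = {{p, y, p2}, {x, p2, p3}, {z, p1, p2}}"
    "pencil p3 = {{p, z, p3}, {x, p2, p3}, {y, p1, p3}}"
    "pencil z = {{p, z, p3}, {z, p1, p2}, {z, u, t}}"
proof -
  have d: "distinct [p, p1, p2, p3, x, y, z, u, t]" using assms by (simp only: cluster_def)
  have B: "{p, x, p1} \<in> B" "{p, y, p2} \<in> B" "{p, z, p3} \<in> B" "{x, p2, p3} \<in> B"
    "{y, p1, p3} \<in> B" "{z, p1, p2} \<in> B" "{z, u, t} \<in> B"
    using assms by (simp_all only: cluster_def)
  show "pencil p = {{p, x, p1}, {p, y, p2}, {p, z, p3}}"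
    by (rule pencil_eq[OF B(1,2,3), where q = x and r = y]) (use d in auto)
  show "pencil p1 = {{p, x, p1}, {y, p1, p3}, {z, p1, p2}}"
    by (rule pencil_eq[OF B(1,5,6), where q = x and r = y]) (use d in auto)
  show "pencil p2 = {{p, y, p2}, {x, p2, p3}, {z, p1, p2}}"
    by (rule pencil_eq[OF B(2,4,6), where q = y and r = x]) (use d in auto)
  show "pencil p3 = {{p, z, p3}, {x, p2, p3}, {y, p1, p3}}"
    by (rule pencil_eq[OF B(3,4,5), where q = z and r = x]) (use d in auto)
  show "pencil z = {{p, z, p3}, {z, p1, p2}, {z, u, t}}"
    by (rule pencil_eq[OF B(3,6,7), where q = p and r = p1]) (use d in auto)
qed

lemma cluster_nb:
  assumes "cluster p p1 p2 p3 x y z u t"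
  shows "nb z = {p, p3, p1, p2, u, t}"
proof -
  have "distinct [p, p1, p2, p3, x, y, z, u, t]" using assms by (simp only: cluster_def)
  then show ?thesis unfolding nb_eq cluster_pencils(5)[OF assms] by auto
qed

lemma cluster_pencil_disjoint:
  assumes c: "cluster p p1 p2 p3 x y z u t" and q: "q \<in> {p, p1, p2, p3}"
    and b: "b \<in> B" "q \<in> b"
  shows "u \<notin> b" "t \<notin> b"
proof -
  have d: "distinct [p, p1, p2, p3, x, y, z, u, t]" using c by (simp only: cluster_def)
  have "\<forall>l\<in>pencil q. l \<subseteq> {p, p1, p2, p3, x, y, z}"
    using q by (elim insertE emptyE) (simp_all add: cluster_pencils(1-4)[OF c])
  then have "b \<subseteq> {p, p1, p2, p3, x, y, z}" using b by (simp add: pencil_def)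
  then show "u \<notin> b" "t \<notin> b" using d by auto
qed

text \<open>Four cluster blocks avoid \<open>z\<close> and contain exactly two of its neighbours.
  Four more irregular blocks come from \<open>u\<close> and \<open>t\<close>: each lies on two
  blocks avoiding \<open>z\<close>, and these contain no other neighbour of
  \<open>z\<close>.\<close>

lemma cluster_irr:
  assumes c: "cluster p p1 p2 p3 x y z u t"
  shows "8 \<le> card (irr z)"
proof -
  have d: "distinct [p, p1, p2, p3, x, y, z, u, t]" using c by (simp only: cluster_def)
  have B: "{p, x, p1} \<in> B" "{p, y, p2} \<in> B" "{x, p2, p3} \<in> B" "{y, p1, p3} \<in> B" "{z, u, t} \<in> B"
    using c by (simp_all only: cluster_def)
  note nb = cluster_nb[OF c]
  let ?L = "{{p, x, p1}, {p, y, p2}, {x, p2, p3}, {y, p1, p3}}"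
  let ?U = "{b \<in> opp z. u \<in> b}" and ?T = "{b \<in> opp z. t \<in> b}"
  have "{p, x, p1} \<inter> nb z = {p, p1}" "{p, y, p2} \<inter> nb z = {p, p2}"
    "{x, p2, p3} \<inter> nb z = {p2, p3}" "{y, p1, p3} \<inter> nb z = {p1, p3}"
    unfolding nb using d by auto
  then have L: "?L \<subseteq> irr z" using B d by (auto simp: irr_def opp_def)
  have single: "b \<inter> nb z = {u} \<or> b \<inter> nb z = {t}" if "b \<in> ?U \<union> ?T" for b
  proof -
    have bB: "b \<in> B" "z \<notin> b" using that by (auto simp: opp_def)
    have "\<not> (u \<in> b \<and> t \<in> b)" using block_eqI[OF B(5) bB(1), of u t] bB(2) d by auto
    moreover have "{p, p1, p2, p3} \<inter> b = {}"
      using cluster_pencil_disjoint[OF c _ bB(1)] that by blast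
    ultimately show ?thesis unfolding nb using that by blast
  qed
  have UT: "?U \<union> ?T \<subseteq> irr z"
  proof
    fix b assume b: "b \<in> ?U \<union> ?T"
    have "card (b \<inter> nb z) = 1" using single[OF b] by auto
    then show "b \<in> irr z" using b by (auto simp: irr_def)
  qed
  have "?U \<inter> ?T = {}"
  proof (rule equals0I)
    fix b assume b: "b \<in> ?U \<inter> ?T"
    then have "u \<in> b \<inter> nb z" "t \<in> b \<inter> nb z" unfolding nb by auto
    moreover have "b \<inter> nb z = {u} \<or> b \<inter> nb z = {t}" using single[of b] b by blast
    ultimately have "t = u" by (metis singletonD)
    then show False using d by simp
  qed
  then have "card (?U \<union> ?T) = 4"
    using card_opp_through[of u z] card_opp_through[of t z] finite_opp
    by (subst card_Un_disjoint) (auto simp: nb)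
  moreover have "card ?L = 4"
  proof -
    have "\<not> {p, x, p1} \<subseteq> {p, y, p2}" "\<not> {p, x, p1} \<subseteq> {x, p2, p3}"
      "\<not> {p, x, p1} \<subseteq> {y, p1, p3}" "\<not> {p, y, p2} \<subseteq> {x, p2, p3}"
      "\<not> {p, y, p2} \<subseteq> {y, p1, p3}" "\<not> {x, p2, p3} \<subseteq> {y, p1, p3}"
      using d by auto
    then have "{p, x, p1} \<noteq> {p, y, p2}" "{p, x, p1} \<noteq> {x, p2, p3}" "{p, x, p1} \<noteq> {y, p1, p3}"
      "{p, y, p2} \<noteq> {x, p2, p3}" "{p, y, p2} \<noteq> {y, p1, p3}" "{x, p2, p3} \<noteq> {y, p1, p3}"
      by (metis order_refl)+
    then show ?thesis by simp
  qed
  moreover have "?L \<inter> (?U \<union> ?T) = {}"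
  proof (rule equals0I, elim IntE)
    let ?F = "{p, p1, p2, p3, x, y}"
    have F: "?L \<subseteq> Pow ?F" "u \<notin> ?F" "t \<notin> ?F" using d by auto
    fix b assume "b \<in> ?L"
    then have "b \<subseteq> ?F" using subsetD[OF F(1)] by (simp only: Pow_iff)
    moreover assume "b \<in> ?U \<union> ?T"
    then have "u \<in> b \<or> t \<in> b" by auto
    ultimately show False using F(2,3) by (metis subsetD)
  qed
  then have "card (?L \<union> (?U \<union> ?T)) = card ?L + card (?U \<union> ?T)"
    using finite_opp by (intro card_Un_disjoint) auto
  ultimately have "card (?L \<union> (?U \<union> ?T)) = 8" by presburger
  moreover have "card (?L \<union> (?U \<union> ?T)) \<le> card (irr z)"
    using L UT by (intro card_mono finite_irr) auto
  ultimately show ?thesis by simp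
qed

section \<open>Discharging\<close>

text \<open>These are the points that may charge \<open>z\<close>.\<close>

definition fiber :: "'a \<Rightarrow> 'a set" where
  "fiber z = {p. \<exists>p1 p2 p3 x y u t. cluster p p1 p2 p3 x y z u t}"

text \<open>Only the six neighbours of \<open>z\<close> can charge it, and \<open>u\<close> is not
  among the chargers.\<close>

lemma card_fiber:
  assumes c: "cluster p p1 p2 p3 x y z u t"
  shows "card (fiber z) \<le> 5"
proof -
  have d: "distinct [p, p1, p2, p3, x, y, z, u, t]" using c by (simp only: cluster_def)
  have "u \<notin> fiber z"
  proof
    assume "u \<in> fiber z"
    then obtain q1 q2 q3 x' y' u' t' where c': "cluster u q1 q2 q3 x' y' z u' t'"
      unfolding fiber_def by blast
    have d': "distinct [u, q1, q2, q3, x', y', z, u', t']" using c' by (simp only: cluster_def)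
    have "{z, q1, q2} \<in> pencil z" using cluster_pencils(5)[OF c'] by simp
    then have "{z, q1, q2} \<in> {{p, z, p3}, {z, p1, p2}, {z, u, t}}"
      using cluster_pencils(5)[OF c] by simp
    \<comment> \<open>In the cluster of \<open>u\<close> this block through \<open>z\<close> misses
      \<open>u\<close>, so it is one of the two blocks of the first cluster. Then \<open>q1\<close>
      is one of \<open>p\<close>, \<open>p1\<close>, \<open>p2\<close>, \<open>p3\<close>, none of
      which is joined to \<open>u\<close>.\<close>
    moreover have "{z, q1, q2} \<noteq> {z, u, t}" using d' by auto
    ultimately have "{z, q1, q2} = {p, z, p3} \<or> {z, q1, q2} = {z, p1, p2}" by blast
    moreover have "q1 \<in> {z, q1, q2}" by simp
    ultimately have "q1 \<in> {p, z, p3} \<or> q1 \<in> {z, p1, p2}" by metis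
    then have "q1 \<in> {p, p1, p2, p3}" using d' by auto
    moreover have "{u, x', q1} \<in> B" using c' by (simp only: cluster_def)
    ultimately show False using cluster_pencil_disjoint(1)[OF c, of q1 "{u, x', q1}"] by auto
  qed
  moreover have "fiber z \<subseteq> nb z"
  proof
    fix q assume "q \<in> fiber z"
    then obtain q1 q2 q3 x' y' u' t' where "cluster q q1 q2 q3 x' y' z u' t'"
      unfolding fiber_def by blast
    then show "q \<in> nb z" using cluster_nb by simp
  qed
  ultimately have "fiber z \<subseteq> nb z - {u}" by auto
  then have "card (fiber z) \<le> card (nb z - {u})" by (intro card_mono) (auto simp: finite_nb)
  also have "\<dots> = 5" unfolding cluster_nb[OF c] using d by auto
  finally show ?thesis .
qed

lemma num_triangles_le:
  assumes "\<not> decomposable P B" "v \<ge> 8"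
  shows "num_triangles B \<le> 3 * v"
proof -
  let ?D = "{p \<in> P. card (irr p) = 2}"
  \<comment> \<open>The last term refunds the deficit of a point with two irregular blocks. An
    uncharged point satisfies this because \<open>card (irr z) \<ge> 2\<close>, a charged one
    because \<open>8 \<ge> 3 + 5\<close>. Summed over \<open>P\<close>, the refunds total
    \<open>card ?D\<close>, which the fibers cover.\<close>
  have *: "3 + card (fiber z) \<le> card (irr z) + of_bool (card (irr z) = 2)" if z: "z \<in> P" for z
  proof (cases "fiber z = {}")
    case True
    then show ?thesis using card_irr_ge_2[OF assms z] by auto
  next
    case False
    then obtain p p1 p2 p3 x y u t where "cluster p p1 p2 p3 x y z u t"
      unfolding fiber_def by blast
    then show ?thesis using cluster_irr[of p p1 p2 p3 x y z u t] card_fiber[of p p1 p2 p3 x y z u t]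
      by linarith
  qed
  have fin: "finite (fiber z)" for z
  proof (rule finite_subset)
    show "fiber z \<subseteq> P" unfolding fiber_def cluster_def using block_subset by blast
  qed (rule finite_points)
  have "?D \<subseteq> (\<Union>z\<in>P. fiber z)"
  proof
    fix p assume "p \<in> ?D"
    then obtain p1 p2 p3 x y z u t where c: "cluster p p1 p2 p3 x y z u t"
      using cluster_exists by blast
    have "{p, z, p3} \<in> B" using c by (simp only: cluster_def)
    then have "z \<in> P" using block_subset by auto
    moreover have "p \<in> fiber z" unfolding fiber_def by (intro CollectI exI) (rule c)
    ultimately show "p \<in> (\<Union>z\<in>P. fiber z)" by blast
  qed
  then have "card ?D \<le> card (\<Union>z\<in>P. fiber z)"
    using finite_points fin by (intro card_mono) auto
  also have "\<dots> \<le> (\<Sum>z\<in>P. card (fiber z))" by (rule card_UN_le[OF finite_points])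
  finally have "3 * v + card ?D \<le> (\<Sum>z\<in>P. 3 + card (fiber z))"
    by (simp add: sum.distrib card_points)
  also have "\<dots> \<le> (\<Sum>z\<in>P. card (irr z) + of_bool (card (irr z) = 2))"
    by (rule sum_mono) (rule *)
  also have "\<dots> = (\<Sum>z\<in>P. card (irr z)) + card ?D"
    using finite_points by (simp add: sum.distrib Int_def)
  finally have "3 * v \<le> (\<Sum>z\<in>P. card (irr z))" by simp
  then show ?thesis using triangles_irr by linarith
qed
end

section \<open>Cyclic configurations, so that the maximum is over a nonempty set\<close>

text \<open>Translates of \<open>{0, 1, 3}\<close>, whose six nonzero differences are distinct
  modulo \<open>v\<close> for \<open>v \<ge> 7\<close>.\<close>

definition cyclic_block :: "nat \<Rightarrow> nat \<Rightarrow> nat set" where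
  "cyclic_block v i = {i, (i + 1) mod v, (i + 3) mod v}"

lemma mem_cyclic_block:
  assumes "7 \<le> v" "i < v"
  shows "x \<in> cyclic_block v i \<longleftrightarrow>
    x < v \<and> (x = i \<or> x = i + 1 \<or> x + v = i + 1 \<or> x = i + 3 \<or> x + v = i + 3)"
  using assms by (auto simp: cyclic_block_def mod_if)

text \<open>Distinct blocks \<open>i < j\<close> meet only if \<open>j - i\<close> is \<open>1\<close>, \<open>2\<close> or \<open>3\<close> up to sign modulo \<open>v\<close>, and the
  difference determines the common point. The disjuncts avoid subtraction and \<open>mod\<close> for the sake
  of linear arithmetic.\<close>

lemma cyclic_block_common:
  assumes v: "7 \<le> v" and ij: "i < j" "j < v"
    and x: "x \<in> cyclic_block v i" "x \<in> cyclic_block v j"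
  shows "j = i + 1 \<and> x = j \<or> j = i + 3 \<and> x = j \<or> i + v = j + 1 \<and> x = i \<or> i + v = j + 3 \<and> x = i \<or>
    j = i + 2 \<and> (x = i + 3 \<or> x + v = i + 3) \<and> x < v \<or> i + v = j + 2 \<and> x = i + 1"
proof -
  have i: "i < v" using ij by simp
  have xi: "x = i \<or> x = i + 1 \<or> x + v = i + 1 \<or> x = i + 3 \<or> x + v = i + 3"
    and xj: "x = j \<or> x = j + 1 \<or> x + v = j + 1 \<or> x = j + 3 \<or> x + v = j + 3"
    and xv: "x < v"
    using x unfolding mem_cyclic_block[OF v i] mem_cyclic_block[OF v ij(2)] by auto
  show ?thesis using xi xj xv v ij by (elim disjE) auto
qed

lemma cyclic_block_eqI:
  assumes v: "7 \<le> v" and ij: "i < v" "j < v" and xy: "x \<noteq> y"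
    and x: "x \<in> cyclic_block v i" "x \<in> cyclic_block v j"
    and y: "y \<in> cyclic_block v i" "y \<in> cyclic_block v j"
  shows "i = j"
proof -
  have False if "i < j" "j < v" "x \<in> cyclic_block v i" "x \<in> cyclic_block v j"
    "y \<in> cyclic_block v i" "y \<in> cyclic_block v j" for i j
    using cyclic_block_common[OF v that(1-4)] cyclic_block_common[OF v that(1,2,5,6)] v xy that(1,2)
    by (elim disjE) auto
  then show ?thesis using ij x y by (metis linorder_neqE_nat)
qed

lemma card_cyclic_block:
  assumes "7 \<le> v" "i < v"
  shows "card (cyclic_block v i) = 3"
  using assms by (auto simp: cyclic_block_def mod_if)

text \<open>Equal blocks share the two distinct points \<open>i\<close> and
  \<open>(i + 1) mod v\<close>.\<close>

lemma inj_cyclic_block: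
  assumes "7 \<le> v"
  shows "inj_on (cyclic_block v) {..<v}"
proof (rule inj_onI)
  fix i j assume ij: "i \<in> {..<v}" "j \<in> {..<v}" "cyclic_block v i = cyclic_block v j"
  have "i \<noteq> (i + 1) mod v" using ij(1) assms by (cases "i + 1 = v") auto
  moreover have "i \<in> cyclic_block v i" "(i + 1) mod v \<in> cyclic_block v i"
    by (simp_all add: cyclic_block_def)
  ultimately show "i = j"
    using cyclic_block_eqI[OF assms, of i j i "(i + 1) mod v"] ij(1,2) unfolding ij(3) by simp
qed

lemma cyclic_pencil:
  assumes "7 \<le> v" "p < v"
  shows "card {i. i < v \<and> p \<in> cyclic_block v i} = 3"
proof -
  \<comment> \<open>The blocks through \<open>p\<close> have the indices \<open>p\<close>,
    \<open>p - 1\<close> and \<open>p - 3\<close> modulo \<open>v\<close>.\<close>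
  let ?q = "if p = 0 then v - 1 else p - 1" and ?r = "if p < 3 then p + v - 3 else p - 3"
  have "{i. i < v \<and> p \<in> cyclic_block v i} = {p, ?q, ?r}"
    using assms by (auto simp: mem_cyclic_block)
  moreover have "p \<noteq> ?q" "p \<noteq> ?r" "?q \<noteq> ?r" using assms by auto
  then have "card {p, ?q, ?r} = 3" by simp
  ultimately show ?thesis by simp
qed

lemma cyclic_sym_configuration:
  assumes v: "7 \<le> v"
  shows "sym_configuration v {..<v} (cyclic_block v ` {..<v})"
proof -
  let ?B = "cyclic_block v ` {..<v}"
  have "card {b \<in> ?B. p \<in> b} = 3" if "p < v" for p
  proof -
    have "{b \<in> ?B. p \<in> b} = cyclic_block v ` {i. i < v \<and> p \<in> cyclic_block v i}" by auto
    moreover have "inj_on (cyclic_block v) {i. i < v \<and> p \<in> cyclic_block v i}"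
      using inj_cyclic_block[OF v] by (rule inj_on_subset) auto
    ultimately show ?thesis using cyclic_pencil[OF v that] by (simp add: card_image)
  qed
  moreover have "card {b \<in> ?B. p \<in> b \<and> q \<in> b} \<le> 1" if "p \<noteq> q" for p q
  proof -
    have "a = b" if "a \<in> {b \<in> ?B. p \<in> b \<and> q \<in> b}" "b \<in> {b \<in> ?B. p \<in> b \<and> q \<in> b}" for a b
      using that cyclic_block_eqI[OF v _ _ \<open>p \<noteq> q\<close>] by blast
    then show ?thesis by (simp add: card_le_Suc0_iff_eq)
  qed
  moreover have "card ?B = v" using inj_cyclic_block[OF v] by (simp add: card_image)
  moreover have "b \<subseteq> {..<v} \<and> card b = 3" if "b \<in> ?B" for b
    using that card_cyclic_block[OF v] mem_cyclic_block[OF v] by auto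
  ultimately show ?thesis unfolding sym_configuration_def by auto
qed

lemma cyclic_not_decomposable:
  assumes v: "7 \<le> v"
  shows "\<not> decomposable {..<v} (cyclic_block v ` {..<v})"
proof
  assume "decomposable {..<v} (cyclic_block v ` {..<v})"
  then obtain v1 v2 P1 P2 B1 B2 where *: "0 < v1" "0 < v2"
    "sym_configuration v1 P1 B1" "sym_configuration v2 P2 B2"
    "P1 \<inter> P2 = {}" "{..<v} = P1 \<union> P2" "cyclic_block v ` {..<v} = B1 \<union> B2"
    unfolding decomposable_def by (elim exE conjE) (rule that)
  have ne: "P1 \<noteq> {}" "P2 \<noteq> {}" using *(1-4) by (auto simp: sym_configuration_def)
  have B: "b \<subseteq> P1" if "b \<in> B1" for b using that *(3) by (simp add: sym_configuration_def)
  have B': "b \<subseteq> P2" if "b \<in> B2" for b using that *(4) by (simp add: sym_configuration_def)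
  \<comment> \<open>Block \<open>i\<close> contains both points and lies in one part, so by
    induction all points are on the side of 0.\<close>
  have step: "(i + 1) mod v \<in> Q \<longleftrightarrow> i \<in> Q" if "i < v" "Q = P1" for i Q
  proof -
    have "cyclic_block v i \<in> B1 \<union> B2" using that *(7) by blast
    then have "cyclic_block v i \<subseteq> P1 \<or> cyclic_block v i \<subseteq> P2" using B B' by blast
    then show ?thesis using *(5) that by (auto simp: cyclic_block_def)
  qed
  have "i < v \<Longrightarrow> i \<in> P1 \<longleftrightarrow> 0 \<in> P1" for i
  proof (induction i)
    case (Suc i)
    then show ?case using step[of i P1] by simp
  qed simp
  then show False using ne *(5,6) by blast
qed

lemma cyclic_connected_configuration:
  "7 \<le> v \<Longrightarrow> connected_configuration v {..<v} (cyclic_block v ` {..<v})"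
  by (simp add: connected_configuration_def cyclic_sym_configuration cyclic_not_decomposable)

theorem theorem3p1:
  fixes v :: nat
  assumes "v \<ge> 8"
  shows "max_triangles v \<le> 3 * v"
proof -
  let ?S = "{num_triangles B | (P :: nat set) (B :: nat set set). connected_configuration v P B}"
  have le: "n \<le> 3 * v" if n: "n \<in> ?S" for n
  proof -
    obtain P :: "nat set" and B where "n = num_triangles B" "connected_configuration v P B"
      using n by blast
    then show ?thesis
      using configuration.num_triangles_le[of v P B] assms
      by (simp add: connected_configuration_def configuration_def)
  qed
  \<comment> \<open>The bound itself makes the set of values finite, as \<open>Max\<close>
    requires.\<close>
  then have "finite ?S" by (intro finite_subset[of ?S "{..3 * v}"]) auto
  moreover have "num_triangles (cyclic_block v ` {..<v}) \<in> ?S"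
    using cyclic_connected_configuration[of v] assms by auto
  ultimately show ?thesis unfolding max_triangles_def using le by (intro Max.boundedI) auto
qed

end
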